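(* Let $p\ge 1$ be an integer and let $f(z)=z^p+\sum_{n=p+1}^\infty a_nz^n$ be analytic in $\mathbb D$. Let $\gamma_0=0.383\ldots$ be the root of the equation $$2\gamma+\frac{2}{\pi}\tan^{-1}\gamma=1.$$ If $$\left|\arg\{f^{(p)}(z)\}\right|<\frac{\pi}{2}\left(\gamma_0+\frac{2}{\pi}\tan^{-1}\gamma_0\right)\quad\text{for all } z\in\mathbb D,$$ then $f$ is $p$-valently starlike in $\mathbb D$, that is, $$\left|\arg\left\{\frac{zf'(z)}{f(z)}\right\}\right|<\frac{\pi}{2}\quad\text{for all } z\in\mathbb D.$$
   Context: $\mathbb D=\{z\in\mathbb C:|z|<1\}$. $f^{(j)}$ is the $j$-th derivative of $f$, with $f^{(0)}=f$. The quotient $zf'(z)/f(z)$ is understood at $z=0$ by its (removable-singularity) analytic extension. $\arg$ denotes the principal argument; a statement $|\arg w|<c$ includes that $w$ is well defined and $w\neq 0$. *)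

theory Defs
  imports "HOL-Complex_Analysis.Complex_Analysis"
begin

text \<open>The class of functions \<open>f(z) = z^p + (\<Sum>n\<ge>p+1. a\<^sub>n z^n)\<close> analytic in the unit disc.\<close>

definition normalized_valent :: "nat \<Rightarrow> (complex \<Rightarrow> complex) \<Rightarrow> bool" where
  "normalized_valent p f \<longleftrightarrow>
     f holomorphic_on ball 0 1 \<and>
     (\<exists>a :: nat \<Rightarrow> complex. \<forall>z\<in>ball 0 1.
        (\<lambda>k. a (p + 1 + k) * z ^ (p + 1 + k)) sums (f z - z ^ p))"

text \<open>
  The quotient \<open>z f'(z) / f(z)\<close>, with only the singularity at the origin removed:
  \<^const>\<open>remove_sings\<close> yields the limit at \<open>0\<close> if it exists, and \<open>0\<close> otherwise.
\<close>

definition starlike_quotient :: "(complex \<Rightarrow> complex) \<Rightarrow> complex \<Rightarrow> complex" where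
  "starlike_quotient f z =
     (if z = 0 then remove_sings (\<lambda>w. w * deriv f w / f w) 0
      else z * deriv f z / f z)"

text \<open>
  Well-definedness of the argument requires \<open>f z \<noteq> 0\<close> away from the origin, and a nonzero
  quotient everywhere, as \<^term>\<open>Arg 0 = 0\<close>. At the origin, the second condition entails
  that the limit exists.
\<close>

definition valently_starlike :: "nat \<Rightarrow> (complex \<Rightarrow> complex) \<Rightarrow> bool" where
  "valently_starlike p f \<longleftrightarrow>
     normalized_valent p f \<and>
     (\<forall>z\<in>ball 0 1. (z \<noteq> 0 \<longrightarrow> f z \<noteq> 0) \<and> starlike_quotient f z \<noteq> 0 \<and>
        \<bar>Arg (starlike_quotient f z)\<bar> < pi / 2)"

lemma gamma_root_unique:
  fixes x y :: real
  assumes "2 * x + 2 / pi * arctan x = 1" "2 * y + 2 / pi * arctan y = 1"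
  shows "x = y"
proof -
  have less: "2 * u + 2 / pi * arctan u < 2 * v + 2 / pi * arctan v"
    if "u < v" for u v :: real
    using that by (intro add_strict_mono mult_strict_left_mono) (auto simp: arctan_less_iff)
  show ?thesis
    using less[of x y] less[of y x] assms by (cases x y rule: linorder_cases) auto
qed

lemma gamma_root_exists:
  "\<exists>\<gamma>::real. 2 * \<gamma> + 2 / pi * arctan \<gamma> = 1 \<and> 0.383 < \<gamma> \<and> \<gamma> < 0.384"
proof -
  define g where "g = (\<lambda>x::real. 2 * x + 2 / pi * arctan x)"
  have lo: "arctan 0.383 \<le> (0.366::real)"
    using arctan_bounds(2)[of "0.383" 2] by (simp add: eval_nat_numeral)
  have hi: "arctan 0.384 \<ge> (0.3655::real)"
    using arctan_bounds(1)[of "0.384" 2] by (simp add: eval_nat_numeral)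
  have A: "g 0.383 < 1"
    using lo pi_approx unfolding g_def by (simp add: field_simps)
  have B: "g 0.384 > 1"
    using hi pi_approx unfolding g_def by (simp add: field_simps)
  have "\<exists>x\<ge>0.383. x \<le> 0.384 \<and> g x = 1"
    by (rule IVT') (use A B in \<open>auto simp: g_def intro!: continuous_intros\<close>)
  then obtain x where x: "0.383 \<le> x" "x \<le> 0.384" "g x = 1"
    by blast
  have "x \<noteq> 0.383" "x \<noteq> 0.384"
    using A B x(3) by (metis less_irrefl)+
  with x have "g x = 1 \<and> 0.383 < x \<and> x < 0.384"
    by linarith
  then show ?thesis
    unfolding g_def ..
qed

end

theory Submission
  imports Defs
begin

text \<open>
  Write \<open>f(z) = z^p v\<^sub>0(z)\<close>, so that \<open>f\<^sup>(\<^sup>j\<^sup>)(z) = z^(p-j) v\<^sub>j(z)\<close> with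
  \<open>v\<^sub>j\<^sub>+\<^sub>1 = (p-j) v\<^sub>j + z v\<^sub>j'\<close>. For \<open>q = v\<^sub>p\<^sub>-\<^sub>1\<close> we have \<open>f\<^sup>(\<^sup>p\<^sup>) = q + z q'\<close>.
  At a point of least modulus where \<open>|arg q|\<close> reaches \<open>\<pi>\<gamma>/2\<close>, Nunokawa's lemma gives
  \<open>z q'/q = \<plusminus>i\<gamma>K\<close> with \<open>K \<ge> 1\<close>, hence \<open>|arg(q + z q')| \<ge> \<pi>\<gamma>/2 + arctan \<gamma>\<close>, which
  the hypothesis excludes. So \<open>|arg q| < \<pi>\<gamma>/2\<close>, and the equation for \<open>\<gamma>\<close> yields
  \<open>Re (v\<^sub>p / v\<^sub>p\<^sub>-\<^sub>1) > 0\<close>. Positivity of \<open>Re (v\<^sub>j\<^sub>+\<^sub>1 / v\<^sub>j)\<close> then descends to \<open>j = 0\<close>: the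
  reciprocal \<open>h = v\<^sub>j / v\<^sub>j\<^sub>+\<^sub>1\<close> satisfies \<open>z h' + (1 + W) h = 1\<close> with
  \<open>W = v\<^sub>j\<^sub>+\<^sub>2 / v\<^sub>j\<^sub>+\<^sub>1\<close>, while \<open>z h'\<close> is real and nonpositive where \<open>Re h\<close> first vanishes.
\<close>

section \<open>Touching points of least modulus\<close>

text \<open>The points with \<open>u z \<le> 0\<close> in the closed disc of radius
  \<open>norm z1\<close> form a compact set, and a member of least modulus serves as
  \<open>z0\<close>.\<close>

lemma first_touch_point:
  fixes u :: "complex \<Rightarrow> real"
  assumes cont: "continuous_on (ball 0 1) u" and u0: "u 0 > 0"
    and z1: "z1 \<in> ball 0 1" "u z1 \<le> 0"
  obtains z0 where "z0 \<in> ball 0 1" "z0 \<noteq> 0" "u z0 = 0"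
    "\<And>z. norm z < norm z0 \<Longrightarrow> u z > 0"
proof -
  define K where "K = {z \<in> cball 0 (norm z1). u z \<le> 0}"
  have sub: "cball 0 (norm z1) \<subseteq> (ball 0 1 :: complex set)"
    using z1 by auto
  have "closed (cball 0 (norm z1) \<inter> u -` {..0})"
    by (rule continuous_closed_preimage[OF continuous_on_subset[OF cont sub]]) auto
  moreover have "cball 0 (norm z1) \<inter> u -` {..0} = K"
    unfolding K_def by auto
  ultimately have "compact K"
    by (metis compact_Int_closed compact_cball inf.left_idem)
  moreover have "z1 \<in> K"
    using z1 by (simp add: K_def)
  ultimately obtain z0 where z0: "z0 \<in> K" and min: "\<And>z. z \<in> K \<Longrightarrow> norm z0 \<le> norm z"
    using continuous_attains_inf[of K norm] continuous_on_norm_id by blast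
  have pos: "u z > 0" if "norm z < norm z0" for z
    using min[of z] that z0 by (force simp: K_def)
  have ball: "z0 \<in> ball 0 1" and nz: "z0 \<noteq> 0"
    using z0 sub u0 by (auto simp: K_def)
  have "u z0 \<ge> 0"
  \<comment> \<open>\<open>z0\<close> is approached along its own radius, where \<open>u\<close> is
    still positive.\<close>
  proof (rule tendsto_lowerbound)
    have "((\<lambda>t. u (of_real t * z0)) \<longlongrightarrow> u (of_real 1 * z0)) (at_left 1)"
    proof (rule isCont_tendsto_compose[of _ u])
      show "isCont u (of_real 1 * z0)"
        using continuous_on_interior[OF cont] ball by simp
    qed (intro tendsto_intros)
    then show "((\<lambda>t. u (of_real t * z0)) \<longlongrightarrow> u z0) (at_left 1)"
      by simp
    show "\<forall>\<^sub>F t in at_left (1::real). 0 \<le> u (of_real t * z0)"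
      using eventually_at_left_real[OF zero_less_one]
      by (rule eventually_mono) (use nz in \<open>auto simp: norm_mult intro!: less_imp_le pos\<close>)
  qed auto
  with z0 have "u z0 = 0"
    by (simp add: K_def)
  with that ball nz pos show thesis
    by blast
qed

lemma has_real_derivative_Re_comp_curve:
  assumes "h holomorphic_on ball 0 1" "\<zeta> t \<in> ball 0 1" "(\<zeta> has_vector_derivative d) (at t)"
  shows "((\<lambda>t. Re (h (\<zeta> t))) has_real_derivative Re (d * deriv h (\<zeta> t))) (at t)"
proof -
  have "(h has_field_derivative deriv h (\<zeta> t)) (at (\<zeta> t))"
    using assms by (intro holomorphic_derivI[of h "ball 0 1"]) auto
  from field_vector_diff_chain_at[OF assms(3) this]
  have "((\<lambda>t. h (\<zeta> t)) has_vector_derivative d * deriv h (\<zeta> t)) (at t)"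
    by (simp add: o_def)
  then show ?thesis
    unfolding has_real_derivative_iff_has_vector_derivative
    using bounded_linear.has_vector_derivative[OF bounded_linear_Re] by blast
qed

lemma has_vector_derivative_ray: "((\<lambda>t. complex_of_real t * z) has_vector_derivative z) (at t)"
  unfolding has_vector_derivative_def by (auto intro!: derivative_eq_intros simp: scaleR_conv_of_real)

lemma has_vector_derivative_circle: "((\<lambda>t. z * cis t) has_vector_derivative z * \<i>) (at 0)"
  unfolding has_vector_derivative_def
  by (auto intro!: derivative_eq_intros has_derivative_cis simp: scaleR_conv_of_real)

text \<open>\<open>z0\<close> minimizes \<open>Re h\<close> on its circle, so the tangential
  derivative vanishes. Along the radius nonnegative values end in 0, so the outward derivative is at
  most 0.\<close>

lemma deriv_at_touch_point:
  assumes hol: "h holomorphic_on ball 0 1" and z0: "z0 \<in> ball 0 1" and eq: "Re (h z0) = 0"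
    and pos: "\<And>z. norm z < norm z0 \<Longrightarrow> Re (h z) \<ge> 0"
  shows "Im (z0 * deriv h z0) = 0" "Re (z0 * deriv h z0) \<le> 0"
proof -
  have ray: "((\<lambda>t. Re (h (of_real t * z))) has_real_derivative Re (z * deriv h z)) (at 1)"
    if "z \<in> ball 0 1" for z
    using has_real_derivative_Re_comp_curve[OF hol _ has_vector_derivative_ray, of 1 z] that
    by simp
  \<comment> \<open>Radial limits carry nonnegativity from the open disc to the circle through
    \<open>z0\<close>.\<close>
  have lim: "Re (h z) \<ge> 0" if "norm z = norm z0" "z0 \<noteq> 0" for z
  proof (rule tendsto_lowerbound)
    show "((\<lambda>t. Re (h (of_real t * z))) \<longlongrightarrow> Re (h z)) (at_left 1)"
      using DERIV_isCont[OF ray[of z]] that z0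
      by (simp add: isCont_def filterlim_at_split)
    show "\<forall>\<^sub>F t in at_left (1::real). 0 \<le> Re (h (of_real t * z))"
      using eventually_at_left_real[OF zero_less_one]
      by (rule eventually_mono) (use that in \<open>auto simp: norm_mult intro!: pos\<close>)
  qed auto
  have "((\<lambda>t. Re (h (z0 * cis t))) has_real_derivative Re (z0 * \<i> * deriv h z0)) (at 0)"
    using has_real_derivative_Re_comp_curve[OF hol _ has_vector_derivative_circle, of z0] z0
    by simp
  then have "z0 \<noteq> 0 \<Longrightarrow> Re (z0 * \<i> * deriv h z0) = 0"
    by (rule DERIV_local_min[of _ _ 0 1]) (auto simp: eq norm_mult intro!: lim)
  then show "Im (z0 * deriv h z0) = 0"
    by (cases "z0 = 0") (auto simp: algebra_simps)
  show "Re (z0 * deriv h z0) \<le> 0"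
  proof (rule ccontr)
    assume *: "\<not> ?thesis"
    then obtain d where d: "d > 0" "\<And>s. 0 < s \<Longrightarrow> s < d \<Longrightarrow> Re (h (of_real (1 - s) * z0)) < 0"
      using DERIV_pos_inc_left[OF ray[OF z0]] eq by auto
    have "Re (h (of_real (1 - min (d/2) (1/2)) * z0)) < 0"
      using d(1) by (intro d(2)) auto
    moreover have "norm (of_real (1 - min (d/2) (1/2)) * z0) < norm z0"
    proof -
      have "z0 \<noteq> 0" "1 - min (d/2) (1/2) < 1" "0 \<le> 1 - min (d/2) (1/2)"
        using * d(1) by auto
      then show ?thesis
        by (simp only: norm_mult norm_of_real abs_of_nonneg mult_less_cancel_right1 zero_less_norm_iff) auto
    qed
    ultimately show False
      using pos by fastforce
  qed
qed

text \<open>At a first zero of \<open>Re h\<close> the number \<open>z * deriv h z\<close> is real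
  and at most 0, which \<open>touch\<close> contradicts. Positivity on the whole disc thus becomes a
  pointwise computation.\<close>

lemma Re_pos_by_touch_points:
  assumes hol: "h holomorphic_on ball 0 1" and "Re (h 0) > 0"
    and touch: "\<And>z. z \<in> ball 0 1 \<Longrightarrow> Re (h z) = 0 \<Longrightarrow> Im (z * deriv h z) = 0 \<Longrightarrow> Re (z * deriv h z) > 0"
    and z: "z \<in> ball 0 1"
  shows "Re (h z) > 0"
proof (rule ccontr)
  assume "\<not> ?thesis"
  then have le: "Re (h z) \<le> 0"
    by simp
  have cont: "continuous_on (ball 0 1) (\<lambda>z. Re (h z))"
    using holomorphic_on_imp_continuous_on[OF hol] by (intro continuous_intros)
  obtain z0 where z0: "z0 \<in> ball 0 1" "Re (h z0) = 0"
    and pos: "\<And>z. norm z < norm z0 \<Longrightarrow> Re (h z) > 0"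
    using first_touch_point[OF cont assms(2) z le] by blast
  note deriv_at_touch_point[OF hol z0 less_imp_le[OF pos]]
  with touch[OF z0] show False
    by linarith
qed

section \<open>Nunokawa's lemma\<close>

text \<open>For w = x + iy the squared modulus of tanh(w/2) is (cosh x - cos y) / (cosh x + cos y).
  As cos y > 0, it is least at x = 0, where it equals tan(y/2)^2.\<close>

lemma tan_half_Im_le:
  assumes "\<bar>Im w\<bar> < pi / 2"
  shows "tan (Im w / 2) \<le> norm ((exp w - 1) / (exp w + 1))"
proof -
  define x y where "x = Re w" and "y = Im w"
  have c: "cos y > 0"
    using assms by (intro cos_gt_zero_pi) (auto simp: y_def)
  have e: "2 * exp x \<le> (exp x)\<^sup>2 + 1"
    using sum_squares_bound[of "exp x" 1] by simp
  have n1: "(norm (exp w - 1))\<^sup>2 = (exp x)\<^sup>2 + 1 - 2 * exp x * cos y"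
   and n2: "(norm (exp w + 1))\<^sup>2 = (exp x)\<^sup>2 + 1 + 2 * exp x * cos y"
    unfolding cmod_power2 x_def y_def Re_exp Im_exp
    by (simp_all add: Re_exp Im_exp power2_eq_square algebra_simps)
      (use sin_cos_squared_add[of "Im w"] in algebra)+
  have "cos (y / 2) \<noteq> 0"
    using assms by (intro less_imp_neq[symmetric] cos_gt_zero_pi) (auto simp: y_def)
  then have cy: "cos y = (1 - (tan (y / 2))\<^sup>2) / (1 + (tan (y / 2))\<^sup>2)"
    using cos_tan_half[of "y / 2"] by simp
  have "1 + (tan (y / 2))\<^sup>2 \<noteq> 0"
    by (metis add_pos_nonneg less_irrefl zero_le_power2 zero_less_one)
  with cy c have "(tan (y / 2))\<^sup>2 = (1 - cos y) / (1 + cos y)"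
    by (simp add: field_simps)
  also have "\<dots> \<le> ((exp x)\<^sup>2 + 1 - 2 * exp x * cos y) / ((exp x)\<^sup>2 + 1 + 2 * exp x * cos y)"
  proof -
    \<comment> \<open>This is the difference of the two sides after cross-multiplication.\<close>
    have "0 \<le> 2 * cos y * ((exp x)\<^sup>2 + 1 - 2 * exp x)"
      using c e by (intro mult_nonneg_nonneg) auto
    moreover have "0 < 1 + cos y" "0 < (exp x)\<^sup>2 + 1 + 2 * exp x * cos y"
      using c by (auto intro!: add_pos_pos)
    ultimately show ?thesis
      by (simp add: divide_simps) (simp add: algebra_simps)
  qed
  also have "\<dots> = (norm ((exp w - 1) / (exp w + 1)))\<^sup>2"
    by (simp add: norm_divide power_divide n1 n2)
  finally show ?thesis
    unfolding y_def by (rule power2_le_imp_le) auto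
qed

text \<open>
  Nunokawa's lemma in logarithmic form: the Schwarz lemma for \<open>tanh (M / 2)\<close> bounds
  \<open>tan (Im M / 2)\<close> by \<open>t\<close> at the point \<open>t * z0\<close>, with equality at \<open>t = 1\<close>.
\<close>

lemma strip_touch_point:
  assumes hol: "M holomorphic_on ball 0 1" and M0: "M 0 = 0" and z0: "z0 \<in> ball 0 1"
    and eq: "Im (M z0) = pi / 2"
    and less: "\<And>z. norm z < norm z0 \<Longrightarrow> \<bar>Im (M z)\<bar> < pi / 2"
  shows "Re (z0 * deriv M z0) = 0" "Im (z0 * deriv M z0) \<ge> 1"
proof -
  define r where "r = norm z0"
  have r: "0 < r" "r < 1"
    using z0 eq M0 by (auto simp: r_def)
  \<comment> \<open>The real part of this function is pi/2 - Im M, which is nonnegative inside the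
    circle and zero at \<open>z0\<close>.\<close>
  have "Im (z0 * deriv (\<lambda>z. of_real (pi/2) + \<i> * M z) z0) = 0"
  proof (rule deriv_at_touch_point)
    show "(\<lambda>z. of_real (pi/2) + \<i> * M z) holomorphic_on ball 0 1"
      by (intro holomorphic_intros hol)
    show "Re (of_real (pi/2) + \<i> * M z) \<ge> 0" if "norm z < norm z0" for z
      using less[OF that] by (simp add: abs_less_iff)
  qed (use z0 eq in simp_all)
  moreover have "deriv (\<lambda>z. of_real (pi/2) + \<i> * M z) z0 = \<i> * deriv M z0"
    by (rule DERIV_imp_deriv) (auto intro!: derivative_eq_intros holomorphic_derivI[OF hol] z0)
  ultimately show "Re (z0 * deriv M z0) = 0"
    by simp
  \<comment> \<open>This is tanh(M/2), rescaled so that the unit disc corresponds exactly to the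
    disc on which \<open>less\<close> holds.\<close>
  define \<phi> where "\<phi> = (\<lambda>z. (exp (M (of_real r * z)) - 1) / (exp (M (of_real r * z)) + 1))"
  have exp_pos: "Re (exp (M (of_real r * z))) > 0" if "norm z < 1" for z
  proof -
    have "norm (of_real r * z) < norm z0"
      using that r by (simp add: norm_mult r_def)
    then have "cos (Im (M (of_real r * z))) > 0"
      using less[of "of_real r * z"] by (intro cos_gt_zero_pi) auto
    then show ?thesis
      by (simp add: Re_exp)
  qed
  have nz: "exp (M (of_real r * z)) + 1 \<noteq> 0" if "norm z < 1" for z
    using exp_pos[OF that] by (auto simp: complex_eq_iff)
  have "(\<lambda>z. M (of_real r * z)) holomorphic_on ball 0 1"
  proof (rule holomorphic_on_compose_gen[OF _ hol, unfolded o_def])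
    show "(\<lambda>z. complex_of_real r * z) ` ball 0 1 \<subseteq> ball 0 1"
    proof (intro image_subsetI)
      fix z :: complex assume "z \<in> ball 0 1"
      then have "r * norm z < 1 * 1"
        using r by (intro mult_strict_mono) auto
      then show "of_real r * z \<in> ball 0 1"
        using r by (simp add: norm_mult)
    qed
  qed (intro holomorphic_intros)
  then have "\<phi> holomorphic_on ball 0 1"
    unfolding \<phi>_def using nz by (intro holomorphic_intros) auto
  moreover have "norm (\<phi> z) < 1" if "norm z < 1" for z
  proof -
    \<comment> \<open>Points of the right half-plane are closer to 1 than to -1.\<close>
    have "norm (w - 1) < norm (w + 1)" if "Re w > 0" for w :: complex
    proof (rule power2_less_imp_less)
      show "(norm (w - 1))\<^sup>2 < (norm (w + 1))\<^sup>2"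
        using that unfolding cmod_power2 by (simp add: power2_eq_square algebra_simps)
    qed simp
    from this[OF exp_pos[OF that]] show ?thesis
      using nz[OF that] unfolding \<phi>_def norm_divide by simp
  qed
  ultimately have schwarz: "norm (\<phi> z) \<le> norm z" if "norm z < 1" for z
    using Schwarz_Lemma(1)[of \<phi> z] that by (simp add: \<phi>_def M0)
  have "Im (M (of_real t * z0)) \<le> 2 * arctan t" if t: "0 < t" "t < 1" for t
  proof -
    let ?w = "of_real t * (z0 / of_real r)"
    have "norm ?w = t"
      using t r by (simp add: norm_mult norm_divide r_def)
    moreover have "of_real r * ?w = of_real t * z0"
      using r by simp
    ultimately have "norm (\<phi> ?w) \<le> t" "\<bar>Im (M (of_real t * z0))\<bar> < pi / 2"
      using schwarz[of ?w] less[of "of_real t * z0"] t r by (auto simp: norm_mult r_def)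
    then have "tan (Im (M (of_real t * z0)) / 2) \<le> t"
      using tan_half_Im_le[of "M (of_real t * z0)"] \<open>of_real r * ?w = _\<close>
      unfolding \<phi>_def by simp
    then have "arctan (tan (Im (M (of_real t * z0)) / 2)) \<le> arctan t"
      by (simp only: arctan_le_iff)
    moreover have "arctan (tan (Im (M (of_real t * z0)) / 2)) = Im (M (of_real t * z0)) / 2"
      using \<open>\<bar>_\<bar> < _\<close> by (intro arctan_tan) auto
    ultimately show ?thesis by simp
  qed
  note le = this
  show "Im (z0 * deriv M z0) \<ge> 1"
  proof (rule ccontr)
    assume *: "\<not> ?thesis"
    \<comment> \<open>By \<open>le\<close>, \<open>g\<close> is at most 0 on (0,1), and it vanishes
      at 1. Its derivative there is \<open>Im (z0 * deriv M z0) - 1\<close>; a negative value would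
      make \<open>g\<close> positive just before 1.\<close>
    define g where "g = (\<lambda>t. Re (-\<i> * M (of_real t * z0)) - 2 * arctan t)"
    have "((\<lambda>t. Re (-\<i> * M (of_real t * z0))) has_real_derivative Re (z0 * deriv (\<lambda>z. -\<i> * M z) z0)) (at 1)"
      using has_real_derivative_Re_comp_curve[OF _ _ has_vector_derivative_ray, of "\<lambda>z. -\<i> * M z" 1 z0] z0
        holomorphic_on_mult[OF holomorphic_on_const hol, of "-\<i>"]
      by simp
    moreover have "deriv (\<lambda>z. -\<i> * M z) z0 = -\<i> * deriv M z0"
      by (rule DERIV_imp_deriv) (auto intro!: derivative_eq_intros holomorphic_derivI[OF hol] z0)
    ultimately have "((\<lambda>t. Re (-\<i> * M (of_real t * z0))) has_real_derivative Im (z0 * deriv M z0)) (at 1)"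
      by simp
    moreover have "((\<lambda>t. 2 * arctan t) has_real_derivative 1) (at 1)"
      by (auto intro!: derivative_eq_intros)
    ultimately have "(g has_real_derivative (Im (z0 * deriv M z0) - 1)) (at 1)"
      unfolding g_def by (rule DERIV_diff)
    then obtain d where d: "d > 0" "\<And>s. 0 < s \<Longrightarrow> s < d \<Longrightarrow> g 1 < g (1 - s)"
      using DERIV_neg_dec_left[of g _ 1] * by (metis diff_less_0_iff_less linorder_not_le)
    define s where "s = min (d/2) (1/2)"
    have s: "0 < s" "s < d" "s < 1"
      using d(1) by (auto simp: s_def)
    have "g 1 = 0"
      using eq by (simp add: g_def arctan_one)
    with d(2)[OF s(1,2)] le[of "1 - s"] s show False
      by (simp add: g_def)
  qed
qed

section \<open>Sector estimate for q from q + z q'\<close>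

lemma Arg_one_plus_imaginary: "Arg (1 + \<i> * of_real y) = arctan y"
proof (rule Arg_unique)
  have c: "cos (arctan y) > 0"
    by (intro cos_gt_zero_pi arctan_lbound arctan_ubound)
  have "sin (arctan y) = y * cos (arctan y)"
    using c tan_arctan[of y] by (simp add: tan_def field_simps)
  with c show "of_real (1 / cos (arctan y)) * exp (\<i> * of_real (arctan y)) = 1 + \<i> * of_real y"
    by (simp add: complex_eq_iff flip: cis_conv_exp)
  show "0 < 1 / cos (arctan y)"
    using c by simp
  show "- pi < arctan y" "arctan y \<le> pi"
    using arctan_lbound[of y] arctan_ubound[of y] by linarith+
qed

text \<open>Where \<open>q\<close> first meets an edge of its sector, q + z q' is q times 1 + is,
  with s of the same sign as the argument of q and modulus at least \<open>\<gamma>\<close>. The two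
  rotations add up and leave the assumed sector.\<close>

lemma sector_of_sector_of_deriv:
  assumes hol: "q holomorphic_on ball 0 1" and q0: "q 0 = of_real c" "c > 0"
    and \<gamma>: "0 < \<gamma>" "pi / 2 * \<gamma> + arctan \<gamma> \<le> pi / 2"
    and nz: "\<And>z. z \<in> ball 0 1 \<Longrightarrow> q z + z * deriv q z \<noteq> 0"
    and sector: "\<And>z. z \<in> ball 0 1 \<Longrightarrow> \<bar>Arg (q z + z * deriv q z)\<bar> < pi / 2 * \<gamma> + arctan \<gamma>"
    and z1: "z1 \<in> ball 0 1"
  shows "q z1 \<noteq> 0" "\<bar>Arg (q z1)\<bar> < pi / 2 * \<gamma>"
proof -
  \<comment> \<open>Positivity comes first, since it makes \<open>Ln (q z)\<close> holomorphic. At a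
    zero of \<open>Re q\<close>, the real part of \<open>z * deriv q z\<close> is that of q + z q',
    which lies in the right half-plane.\<close>
  have Re_pos: "Re (q z) > 0" if "z \<in> ball 0 1" for z
  proof (rule Re_pos_by_touch_points[OF hol])
    fix z assume z: "z \<in> ball 0 1" and "Re (q z) = 0"
    moreover have "Re (q z + z * deriv q z) > 0"
      using sector[OF z] nz[OF z] \<gamma>(2) Arg_Re_pos[of "q z + z * deriv q z"] by force
    ultimately show "Re (z * deriv q z) > 0"
      by simp
  qed (use q0 that in auto)
  from Re_pos[OF z1] show "q z1 \<noteq> 0"
    by auto
  show "\<bar>Arg (q z1)\<bar> < pi / 2 * \<gamma>"
  proof (rule ccontr)
    assume neg: "\<not> ?thesis"
    \<comment> \<open>The logarithm turns the sector into a strip, division by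
      \<open>\<gamma>\<close> gives it half-width pi/2, and subtracting \<open>ln c\<close>
      normalizes \<open>M 0\<close> to 0.\<close>
    define M where "M = (\<lambda>z. (Ln (q z) - of_real (ln c)) / of_real \<gamma>)"
    have nonpos: "q z \<notin> \<real>\<^sub>\<le>\<^sub>0" if "z \<in> ball 0 1" for z
      using Re_pos[OF that] by (auto simp: complex_nonpos_Reals_iff)
    have holM: "M holomorphic_on ball 0 1"
      unfolding M_def using nonpos \<gamma> by (intro holomorphic_intros hol) auto
    have Im_M: "Im (M z) = Arg (q z) / \<gamma>" if "z \<in> ball 0 1" for z
      using Re_pos[OF that] \<gamma> by (subst Arg_eq_Im_Ln) (auto simp: M_def Im_divide_of_real)
    have cont: "continuous_on (ball 0 1) (\<lambda>z. pi / 2 - \<bar>Im (M z)\<bar>)"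
      using holomorphic_on_imp_continuous_on[OF holM] by (intro continuous_intros)
    have M0: "M 0 = 0"
      using q0 by (simp add: M_def Ln_of_real)
    have "pi / 2 - \<bar>Im (M z1)\<bar> \<le> 0"
      using neg \<gamma> by (simp add: Im_M[OF z1] abs_divide field_simps)
    moreover have "pi / 2 - \<bar>Im (M 0)\<bar> > 0"
      by (simp add: M0)
    ultimately obtain z0 where z0: "z0 \<in> ball 0 1" and "pi / 2 - \<bar>Im (M z0)\<bar> = 0"
      and less': "\<And>z. norm z < norm z0 \<Longrightarrow> pi / 2 - \<bar>Im (M z)\<bar> > 0"
      using first_touch_point[OF cont _ z1] by blast
    then have touch: "\<bar>Im (M z0)\<bar> = pi / 2"
      by simp
    have less: "\<bar>Im (M z)\<bar> < pi / 2" if "norm z < norm z0" for z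
      using less'[OF that] by simp
    \<comment> \<open>The sign \<open>\<sigma>\<close> records which edge is met and moves the
      touching point to the upper one.\<close>
    obtain \<sigma> :: real where \<sigma>: "\<sigma> = 1 \<or> \<sigma> = -1" "\<sigma> * Im (M z0) = pi / 2"
      using touch by (cases "Im (M z0) \<ge> 0") (auto intro: that[of 1] that[of "-1"])
    define N where "N = (\<lambda>z. of_real \<sigma> * M z)"
    have "N holomorphic_on ball 0 1" "N 0 = 0" "Im (N z0) = pi / 2"
      using M0 \<sigma>(2) by (auto simp: N_def intro!: holomorphic_intros holM)
    moreover have "\<bar>Im (N z)\<bar> < pi / 2" if "norm z < norm z0" for z
      using less[OF that] \<sigma>(1) by (auto simp: N_def)
    ultimately have "Re (z0 * deriv N z0) = 0" "Im (z0 * deriv N z0) \<ge> 1"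
      using strip_touch_point[of N z0] z0 by blast+
    then obtain K where K: "K \<ge> 1" "z0 * deriv N z0 = \<i> * of_real K"
      by (metis complex_eq mult_zero_left add_0 of_real_0)
    have "deriv N z0 = of_real \<sigma> * ((deriv q z0 / q z0) / of_real \<gamma>)"
      unfolding N_def M_def
      by (rule DERIV_imp_deriv)
        (use nonpos[OF z0] \<gamma> z0 in \<open>auto intro!: derivative_eq_intros holomorphic_derivI[OF hol] simp: field_simps\<close>)
    moreover have "q z0 \<noteq> 0"
      using Re_pos[OF z0] by auto
    \<comment> \<open>Since \<open>\<sigma>\<close> squares to 1, the logarithmic derivative can be
      solved for \<open>deriv q z0\<close>.\<close>
    ultimately have "deriv q z0 = of_real (\<sigma> * \<gamma>) * q z0 * deriv N z0"
      using \<sigma>(1) \<gamma>(1) by auto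
    then have "z0 * deriv q z0 = of_real (\<sigma> * \<gamma>) * q z0 * (z0 * deriv N z0)"
      by (simp add: mult_ac)
    also have "\<dots> = q z0 * (\<i> * of_real (\<sigma> * \<gamma> * K))"
      by (simp only: K(2)) (simp add: mult_ac)
    finally have "z0 * deriv q z0 = q z0 * (\<i> * of_real (\<sigma> * \<gamma> * K))" .
    then have eq: "q z0 + z0 * deriv q z0 = q z0 * (1 + \<i> * of_real (\<sigma> * \<gamma> * K))"
      by (simp add: algebra_simps)
    have Arg_q: "Arg (q z0) = \<sigma> * (pi / 2 * \<gamma>)"
      using \<sigma> \<gamma>(1) Im_M[OF z0] by (auto simp: field_simps)
    have arctan: "arctan (\<sigma> * \<gamma> * K) = \<sigma> * arctan (\<gamma> * K)"
      using \<sigma>(1) by (auto simp: arctan_minus)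
    have mono: "arctan \<gamma> \<le> arctan (\<gamma> * K)" "arctan \<gamma> > 0" "arctan (\<gamma> * K) < pi / 2"
      using \<gamma>(1) K(1) arctan_ubound by (auto simp: arctan_le_iff)
    have "pi / 2 * \<gamma> > 0"
      using \<gamma>(1) by simp
    then have "0 < pi / 2 * \<gamma> + arctan (\<gamma> * K)" "pi / 2 * \<gamma> + arctan (\<gamma> * K) < pi"
      using mono \<gamma>(2) by linarith+
    \<comment> \<open>The sum has modulus below pi, so no multiple of 2 pi enters the argument of
      the product.\<close>
    have "Arg (q z0) + Arg (1 + \<i> * of_real (\<sigma> * \<gamma> * K)) \<in> {-pi<..pi}"
      unfolding Arg_q Arg_one_plus_imaginary arctan
      using \<sigma>(1) \<open>0 < pi / 2 * \<gamma> + _\<close> \<open>_ < pi\<close> by auto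
    then have "Arg (q z0 + z0 * deriv q z0) = Arg (q z0) + Arg (1 + \<i> * of_real (\<sigma> * \<gamma> * K))"
      unfolding eq using Re_pos[OF z0] by (intro Arg_times) (auto simp: complex_eq_iff)
    also have "\<dots> = \<sigma> * (pi / 2 * \<gamma> + arctan (\<gamma> * K))"
      unfolding Arg_q Arg_one_plus_imaginary arctan by (simp add: algebra_simps)
    also have "\<bar>\<dots>\<bar> = pi / 2 * \<gamma> + arctan (\<gamma> * K)"
      using \<sigma>(1) \<open>0 < pi / 2 * \<gamma> + _\<close> by (auto simp: abs_mult)
    finally show False
      using sector[OF z0] mono(1) by linarith
  qed
qed

section \<open>Descent of positivity to lower derivatives\<close>

text \<open>Here \<open>v\<close> and \<open>u\<close> stand for v_j and v_(j+1), and
  \<open>m\<close> for p - j - 1. The reciprocal v/u is holomorphic because \<open>u\<close> has no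
  zeros, so that \<open>v\<close> has none either comes out as a conclusion.\<close>

lemma Re_quotient_pos_step:
  fixes m :: real
  assumes hol: "v holomorphic_on ball 0 1" "u holomorphic_on ball 0 1" and m: "m \<ge> 0"
    and u: "\<And>z. z \<in> ball 0 1 \<Longrightarrow> u z = (of_real m + 1) * v z + z * deriv v z"
    and nz: "\<And>z. z \<in> ball 0 1 \<Longrightarrow> u z \<noteq> 0"
    and pos: "\<And>z. z \<in> ball 0 1 \<Longrightarrow> Re ((of_real m * u z + z * deriv u z) / u z) > 0"
    and z: "z \<in> ball 0 1"
  shows "v z \<noteq> 0 \<and> Re (u z / v z) > 0"
proof -
  define h where "h = (\<lambda>z. v z / u z)"
  have holh: "h holomorphic_on ball 0 1"
    unfolding h_def by (intro holomorphic_intros hol nz)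
  have "h 0 = of_real (1 / (m + 1))"
    using u[of 0] nz[of 0] by (auto simp: h_def divide_simps)
  then have h0: "Re (h 0) > 0"
    using m by (simp only: Re_complex_of_real) simp
  have "Re (h z) > 0"
  proof (rule Re_pos_by_touch_points[OF holh h0 _ z])
    fix z assume z: "z \<in> ball 0 1" and Re0: "Re (h z) = 0" and Im0: "Im (z * deriv h z) = 0"
    define W where "W = (of_real m * u z + z * deriv u z) / u z"
    have "deriv h z = (deriv v z * u z - v z * deriv u z) / (u z * u z)"
      unfolding h_def
      by (rule DERIV_imp_deriv) (intro DERIV_divide holomorphic_derivI[OF hol(1)]
          holomorphic_derivI[OF hol(2)] nz z open_ball)
    then have "deriv h z * u z * u z = deriv v z * u z - v z * deriv u z"
      using nz[OF z] by simp
    then have "z * (deriv h z * u z * u z) = z * (deriv v z * u z - v z * deriv u z)"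
      by simp
    then have "z * deriv h z * u z * u z = (z * deriv v z) * u z - v z * (z * deriv u z)"
      using nz[OF z] by (simp add: algebra_simps)
    also have "z * deriv v z = u z - (of_real m + 1) * v z"
      using u[OF z] by (simp add: algebra_simps)
    also have "z * deriv u z = (W - of_real m) * u z"
      using nz[OF z] by (simp add: W_def field_simps)
    finally have "(z * deriv h z * u z) * u z = (u z - v z * (1 + W)) * u z"
      by (simp add: algebra_simps)
    then have "z * deriv h z * u z = u z - v z * (1 + W)"
      using nz[OF z] by (simp only: mult_cancel_right) simp
    then have eq: "z * deriv h z = 1 - h z * (1 + W)"
      using nz[OF z] by (simp add: h_def field_simps)
    \<comment> \<open>Imaginary parts are compared in \<open>eq\<close>: the left side is real and
      \<open>h z\<close> is purely imaginary. As \<open>Re W > 0\<close>, this forces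
      \<open>h z = 0\<close>, and then \<open>eq\<close> gives
      \<open>z * deriv h z = 1\<close>.\<close>
    then have "Im (h z) * (1 + Re W) = 0"
      using Re0 Im0 by simp
    moreover have "Re W > 0"
      using pos[OF z] by (simp add: W_def)
    ultimately have "h z = 0"
      using Re0 by (auto simp: complex_eq_iff)
    with eq show "Re (z * deriv h z) > 0"
      by simp
  qed
  then have "Re (inverse (h z)) > 0" "h z \<noteq> 0"
    by (auto intro!: divide_pos_pos add_pos_nonneg)
  then show ?thesis
    by (auto simp: h_def)
qed

section \<open>Factoring powers of z out of f and its derivatives\<close>

text \<open>\<open>cofactor p v j\<close> is the factor of \<open>z^(p-j)\<close> in the \<open>j\<close>-th derivative of \<open>z^p * v z\<close>.\<close>

primrec cofactor :: "nat \<Rightarrow> (complex \<Rightarrow> complex) \<Rightarrow> nat \<Rightarrow> complex \<Rightarrow> complex" where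
  "cofactor p v 0 = v"
| "cofactor p v (Suc j) = (\<lambda>z. of_nat (p - j) * cofactor p v j z + z * deriv (cofactor p v j) z)"

lemma holomorphic_cofactor:
  assumes "v holomorphic_on ball 0 1"
  shows "cofactor p v j holomorphic_on ball 0 1"
  by (induction j) (auto intro!: holomorphic_intros assms)

text \<open>At the origin each recursion step only multiplies by a positive integer; the constant is
  p!/(p-j)!.\<close>

lemma cofactor_0_pos:
  assumes "v 0 = 1" "j \<le> p"
  shows "\<exists>c>0. cofactor p v j 0 = of_real c"
  using assms(2)
proof (induction j)
  case 0
  then show ?case
    using assms(1) by (intro exI[of _ 1]) simp
next
  case (Suc j)
  then obtain c where "c > 0" "cofactor p v j 0 = of_real c"
    by auto
  with Suc.prems show ?case
    by (intro exI[of _ "real (p - j) * c"]) simp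
qed

lemma higher_deriv_eq_cofactor:
  assumes v: "v holomorphic_on ball 0 1"
    and f: "\<And>z. z \<in> ball 0 1 \<Longrightarrow> f z = z ^ p * v z"
    and "j \<le> p" "z \<in> ball 0 1"
  shows "(deriv ^^ j) f z = z ^ (p - j) * cofactor p v j z"
  using assms(3,4)
proof (induction j arbitrary: z)
  case 0
  then show ?case
    by (simp add: f)
next
  case (Suc j)
  let ?w = "cofactor p v j"
  obtain k where k: "p - j = Suc k" "p - Suc j = k"
    using Suc.prems(1) by (metis Suc_diff_Suc Suc_le_lessD)
  have "(deriv ^^ Suc j) f z = deriv (\<lambda>z. z ^ Suc k * ?w z) z"
    using Suc k(1)
    by (auto intro!: deriv_cong_ev eventually_nhds_in_open[of "ball 0 1", THEN eventually_mono])
  also have "\<dots> = z ^ k * (of_nat (Suc k) * ?w z + z * deriv ?w z)"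
    by (rule DERIV_imp_deriv, rule DERIV_cong[OF DERIV_mult[OF DERIV_power[OF DERIV_ident]
          holomorphic_derivI[OF holomorphic_cofactor[OF v] open_ball Suc.prems(2)]]])
      (simp add: algebra_simps)
  finally show ?case
    by (simp add: k)
qed

text \<open>Dividing the tail of the series by z^(p+1) leaves a convergent power series
  \<open>s\<close>, and v(z) = 1 + z s(z).\<close>

lemma normalized_valent_factor:
  assumes "normalized_valent p f"
  obtains v where "v holomorphic_on ball 0 1" "v 0 = 1"
    "\<And>z. z \<in> ball 0 1 \<Longrightarrow> f z = z ^ p * v z"
proof -
  obtain a where a: "\<And>z. z \<in> ball 0 1 \<Longrightarrow>
      (\<lambda>k. a (p + 1 + k) * z ^ (p + 1 + k)) sums (f z - z ^ p)"
    using assms unfolding normalized_valent_def by blast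
  define s where "s = (\<lambda>z. \<Sum>k. a (p + 1 + k) * z ^ k)"
  have sums: "(\<lambda>k. a (p + 1 + k) * z ^ k) sums s z" if "z \<in> ball 0 1" for z
  \<comment> \<open>Division by z^(p+1) is impossible at the origin, where convergence is
    trivial.\<close>
  proof (cases "z = 0")
    case True
    then show ?thesis
      using powser_sums_zero[of "\<lambda>k. a (p + 1 + k)"] by (simp add: s_def sums_iff)
  next
    case False
    have "(\<lambda>k. a (p + 1 + k) * z ^ (p + 1 + k) / z ^ (p + 1)) sums ((f z - z ^ p) / z ^ (p + 1))"
      by (intro sums_divide a that)
    with False show ?thesis
      by (simp add: s_def power_add sums_iff)
  qed
  have "s holomorphic_on ball 0 1"
    by (rule power_series_holomorphic[of _ _ "\<lambda>k. a (p + 1 + k)"]) (use sums in simp)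
  moreover have "f z = z ^ p * (1 + z * s z)" if "z \<in> ball 0 1" for z
  proof -
    have "(\<lambda>k. z ^ (p + 1) * (a (p + 1 + k) * z ^ k)) sums (z ^ (p + 1) * s z)"
      by (intro sums_mult sums that)
    moreover have "(\<lambda>k. z ^ (p + 1) * (a (p + 1 + k) * z ^ k)) = (\<lambda>k. a (p + 1 + k) * z ^ (p + 1 + k))"
      by (simp add: power_add mult_ac)
    ultimately have "z ^ (p + 1) * s z = f z - z ^ p"
      using a[OF that] sums_unique2 by metis
    then show ?thesis
      by (simp add: algebra_simps)
  qed
  ultimately show thesis
    by (intro that[of "\<lambda>z. 1 + z * s z"]) (auto intro!: holomorphic_intros)
qed

text \<open>Away from the origin the common factor z^p cancels. The resulting quotient is continuous
  at 0, so its value there is the limit that \<open>remove_sings\<close> returns.\<close>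

lemma starlike_quotient_eq_cofactor:
  assumes v: "v holomorphic_on ball 0 1" and f: "\<And>z. z \<in> ball 0 1 \<Longrightarrow> f z = z ^ p * v z"
    and "p \<ge> 1" and nz: "\<And>z. z \<in> ball 0 1 \<Longrightarrow> v z \<noteq> 0" and z: "z \<in> ball 0 1"
  shows "starlike_quotient f z = cofactor p v 1 z / v z"
proof -
  have eq: "w * deriv f w / f w = cofactor p v 1 w / v w" if "w \<in> ball 0 1" "w \<noteq> 0" for w
  proof -
    have "w * deriv f w = w ^ p * cofactor p v 1 w"
      using higher_deriv_eq_cofactor[OF v f, where j=1 and z=w] that \<open>p \<ge> 1\<close> power_eq_if[of w p]
      by simp
    then show ?thesis
      using that f by simp
  qed
  show ?thesis
  proof (cases "z = 0")
    case True
    have "(\<lambda>w. cofactor p v 1 w / v w) \<midarrow>0\<rightarrow> cofactor p v 1 0 / v 0"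
    proof (rule isContD)
      have "(\<lambda>w. cofactor p v 1 w / v w) holomorphic_on ball 0 1"
        by (intro holomorphic_intros holomorphic_cofactor v nz)
      then show "isCont (\<lambda>w. cofactor p v 1 w / v w) 0"
        using continuous_on_interior[OF holomorphic_on_imp_continuous_on] by fastforce
    qed
    moreover have "\<forall>\<^sub>F w in at 0. cofactor p v 1 w / v w = w * deriv f w / f w"
      using eventually_at_in_open[of "ball 0 1" "0::complex"]
      by (rule eventually_mono) (auto simp: eq simp del: cofactor.simps)
    ultimately have "(\<lambda>w. w * deriv f w / f w) \<midarrow>0\<rightarrow> cofactor p v 1 0 / v 0"
      by (rule Lim_transform_eventually)
    with True show ?thesis
      by (simp add: starlike_quotient_def remove_sings_eqI)
  next
    case False
    then show ?thesis
      using eq[OF z] by (simp add: starlike_quotient_def)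
  qed
qed

section \<open>Starlikeness from the sector condition on the p-th derivative\<close>

theorem corollary2p3:
  fixes p :: nat and f :: "complex \<Rightarrow> complex" and \<gamma>\<^sub>0 :: real
  assumes "p \<ge> 1"
    and "normalized_valent p f"
    and "2 * \<gamma>\<^sub>0 + 2 / pi * arctan \<gamma>\<^sub>0 = 1"
    and "\<And>z. z \<in> ball 0 1 \<Longrightarrow> (deriv ^^ p) f z \<noteq> 0 \<and>
           \<bar>Arg ((deriv ^^ p) f z)\<bar> < pi / 2 * (\<gamma>\<^sub>0 + 2 / pi * arctan \<gamma>\<^sub>0)"
  shows "valently_starlike p f"
proof -
  obtain v where v: "v holomorphic_on ball 0 1" "v 0 = 1"
    and f: "\<And>z. z \<in> ball 0 1 \<Longrightarrow> f z = z ^ p * v z"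
    using normalized_valent_factor[OF assms(2)] by metis
  let ?v = "cofactor p v"
  note holv = holomorphic_cofactor[OF v(1)]
  \<comment> \<open>Uniqueness identifies \<open>\<gamma>\<^sub>0\<close> with the root between
    0.383 and 0.384.\<close>
  have \<gamma>: "\<gamma>\<^sub>0 > 0"
    using gamma_root_exists gamma_root_unique[OF assms(3)] by fastforce
  \<comment> \<open>This is the equation for \<open>\<gamma>\<^sub>0\<close> times pi/2: the
    half-openings of the sectors for \<open>?v p\<close> and \<open>q\<close> add up to
    pi/2.\<close>
  have sum: "pi / 2 * \<gamma>\<^sub>0 + arctan \<gamma>\<^sub>0 = pi / 2 - pi / 2 * \<gamma>\<^sub>0"
    using assms(3) pi_gt_zero by (simp add: field_simps)
  have vp: "?v p z \<noteq> 0" "\<bar>Arg (?v p z)\<bar> < pi / 2 * \<gamma>\<^sub>0 + arctan \<gamma>\<^sub>0" if "z \<in> ball 0 1" for z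
    using assms(4)[OF that] higher_deriv_eq_cofactor[OF v(1) f order_refl that]
    by (auto simp: distrib_left)
  define q where "q = ?v (p - 1)"
  have vp_eq: "?v p z = q z + z * deriv q z" for z
    using assms(1) cofactor.simps(2)[of p v "p - 1"] by (simp add: q_def)
  obtain c where c: "c > 0" "q 0 = of_real c"
    using cofactor_0_pos[of v "p - 1" p] v(2) by (auto simp: q_def)
  have q: "q z \<noteq> 0" "\<bar>Arg (q z)\<bar> < pi / 2 * \<gamma>\<^sub>0" if "z \<in> ball 0 1" for z
  proof -
    have "pi / 2 * \<gamma>\<^sub>0 + arctan \<gamma>\<^sub>0 \<le> pi / 2"
      unfolding sum using \<gamma> by simp
    note sector_of_sector_of_deriv[OF holv[of p "p - 1", folded q_def] c(2,1) \<gamma> this vp[unfolded vp_eq] that]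
    then show "q z \<noteq> 0" "\<bar>Arg (q z)\<bar> < pi / 2 * \<gamma>\<^sub>0"
      by blast+
  qed
  \<comment> \<open>The induction runs downwards, from p - 1 to 0.\<close>
  have main: "\<forall>z\<in>ball 0 1. ?v 0 z \<noteq> 0 \<and> Re (?v (Suc 0) z / ?v 0 z) > 0"
    using le0[of "p - 1"]
  proof (induction rule: inc_induct)
    case base
    show ?case
    proof
      fix z :: complex assume z: "z \<in> ball 0 1"
      have "\<bar>Arg (?v p z / q z)\<bar> < pi / 2"
      proof -
        \<comment> \<open>The two sector bounds are added; being below pi, the difference is exactly
          the argument of the quotient.\<close>
        have "\<bar>Arg (?v p z) - Arg (q z)\<bar> < pi / 2"
          using q(2)[OF z] vp(2)[OF z] unfolding sum by linarith
        moreover from this have "\<not> Arg (?v p z) - Arg (q z) > pi" "\<not> Arg (?v p z) - Arg (q z) \<le> - pi"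
          using pi_gt_zero by linarith+
        ultimately show ?thesis
          using Arg_divide'[OF vp(1)[OF z] q(1)[OF z]] by simp
      qed
      then show "?v (p - 1) z \<noteq> 0 \<and> Re (?v (Suc (p - 1)) z / ?v (p - 1) z) > 0"
        using Arg_Re_pos[of "?v p z / q z"] vp(1)[OF z] q(1)[OF z] assms(1) by (simp add: q_def)
    qed
  next
    case (step j)
    \<comment> \<open>As \<open>j < p - 1\<close>, no truncation occurs: p - j is
      \<open>m + 1\<close>, where \<open>m\<close> is the factor p - (j + 1) of the next recursion
      step.\<close>
    have j: "(of_nat (p - j) :: complex) = of_real (real (p - Suc j)) + 1"
      using step.hyps by (simp add: of_nat_diff)
    show ?case
    proof (intro ballI, rule Re_quotient_pos_step[OF holv holv, where m = "real (p - Suc j)"])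
      fix z :: complex assume z: "z \<in> ball 0 1"
      show "?v (Suc j) z = (of_real (real (p - Suc j)) + 1) * ?v j z + z * deriv (?v j) z"
        by (simp only: cofactor.simps j)
      show "?v (Suc j) z \<noteq> 0"
        using step.IH z by blast
      have "Re (?v (Suc (Suc j)) z / ?v (Suc j) z) > 0"
        using step.IH z by blast
      then show "Re ((of_real (real (p - Suc j)) * ?v (Suc j) z + z * deriv (?v (Suc j)) z)
          / ?v (Suc j) z) > 0"
        by (simp only: cofactor.simps(2)[of p v "Suc j"] of_real_of_nat_eq)
    qed auto
  qed
  then have nz: "v z \<noteq> 0" if "z \<in> ball 0 1" for z
    using that by simp
  show ?thesis
    unfolding valently_starlike_def
  proof (intro conjI ballI impI)
    fix z :: complex assume z: "z \<in> ball 0 1"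
    have sq: "starlike_quotient f z = ?v 1 z / v z"
      by (rule starlike_quotient_eq_cofactor[OF v(1) f assms(1) nz z])
    have pos: "Re (starlike_quotient f z) > 0"
      using main z unfolding sq by simp
    then show "starlike_quotient f z \<noteq> 0"
      by auto
    show "\<bar>Arg (starlike_quotient f z)\<bar> < pi / 2"
      using pos Arg_Re_pos by blast
    show "f z \<noteq> 0" if "z \<noteq> 0"
      using f[OF z] nz[OF z] that by simp
  qed (rule assms(2))
qed

end
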